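(* There is a universal constant $C>0$ such that for every rooted tree $T$ with $n$ nodes and height $h$, every $V\ge 0$ and every $\sigma>0$, the worst case risk of the least squares estimator $\hat\mu$ satisfies $$\sup_{\mu\in\mathcal F(T):\,\mu_1\le V}\ \mathbb E\,\frac1n\|\hat\mu-\mu\|^2\ \le\ \frac{C}{n}\Bigl(\sigma^2h^2\log\bigl(\tfrac nh\bigr)+hV\sigma\sqrt{\log\bigl(\tfrac nh\bigr)}\Bigr).$$
   Context: $T$ is a rooted tree with $n\ge 2$ nodes labelled $1,\dots,n$, node $1$ being the root; $\mathcal C(i)$ is the set of children of node $i$. The height $h$ of $T$ is the maximum graph distance from the root to a leaf (so $h\ge1$). The set of flows on $T$ is the closed convex cone $\mathcal F(T)=\{\mu\in\mathbb R^n:\ \mu_i\ge\sum_{j\in\mathcal C(i)}\mu_j \text{ for all } i\}$, an empty sum being $0$ (so $\mu_i\ge0$ for all $i$). $\mu_1$ is the root flow. One observes $Y_i=\mu_i+\epsilon_i$, $i=1,\dots,n$, with $\epsilon_i$ i.i.d. $N(0,\sigma^2)$ and $\mu\in\mathcal F(T)$ unknown. The least squares estimator is $\hat\mu=\operatorname{argmin}_{f\in\mathcal F(T)}\sum_{i=1}^n(Y_i-f_i)^2$, the Euclidean projection of $Y$ onto $\mathcal F(T)$. $\|\cdot\|$ is the Euclidean norm, and $\mathbb E$ is expectation under the true $\mu$. *)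

theory Defs
  imports "HOL-Probability.Probability"
begin

text \<open>
  A rooted tree on the nodes \<open>1, \<dots>, n\<close> with root \<open>1\<close> is given by its parent-child relation:
  \<open>(i, j) \<in> E\<close> means that \<open>j\<close> is a child of \<open>i\<close>.
\<close>

definition rooted_tree :: "nat \<Rightarrow> (nat \<times> nat) set \<Rightarrow> bool" where
  "rooted_tree n E \<longleftrightarrow>
     1 \<le> n \<and>
     E \<subseteq> {1..n} \<times> {1..n} \<and>
     (\<forall>i. (i, 1) \<notin> E) \<and>
     (\<forall>j\<in>{1..n} - {1}. \<exists>!i. (i, j) \<in> E) \<and>
     (\<forall>j\<in>{1..n}. (1, j) \<in> E\<^sup>*)"

definition children :: "(nat \<times> nat) set \<Rightarrow> nat \<Rightarrow> nat set" where
  "children E i = {j. (i, j) \<in> E}"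

definition leaves :: "nat \<Rightarrow> (nat \<times> nat) set \<Rightarrow> nat set" where
  "leaves n E = {i \<in> {1..n}. children E i = {}}"

text \<open>Graph distance is taken in the underlying undirected graph.\<close>

definition graph_dist :: "(nat \<times> nat) set \<Rightarrow> nat \<Rightarrow> nat \<Rightarrow> nat" where
  "graph_dist E i j = (LEAST k. (i, j) \<in> (E \<union> E\<inverse>) ^^ k)"

definition tree_height :: "nat \<Rightarrow> (nat \<times> nat) set \<Rightarrow> nat" where
  "tree_height n E = Max (graph_dist E 1 ` leaves n E)"

text \<open>
  Since \<open>n\<close> varies inside the theorem, a vector of \<open>\<real>\<^sup>n\<close> is a function on \<open>nat\<close> that is
  \<^const>\<open>undefined\<close> outside \<open>{1..n}\<close>; distinct functions are then distinct vectors, so that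
  the minimiser in \<open>lse\<close> below is unique.
\<close>

definition flows :: "nat \<Rightarrow> (nat \<times> nat) set \<Rightarrow> (nat \<Rightarrow> real) set" where
  "flows n E = {\<mu> \<in> extensional {1..n}. \<forall>i\<in>{1..n}. \<mu> i \<ge> (\<Sum>j\<in>children E i. \<mu> j)}"

definition lse :: "nat \<Rightarrow> (nat \<times> nat) set \<Rightarrow> (nat \<Rightarrow> real) \<Rightarrow> nat \<Rightarrow> real" where
  "lse n E Y = arg_min_on (\<lambda>f. \<Sum>i=1..n. (Y i - f i)\<^sup>2) (flows n E)"

text \<open>The law on \<open>\<real>\<^sup>n\<close> of the noise: independent centred Gaussians of variance \<open>\<sigma>\<^sup>2\<close>.\<close>

definition noise :: "nat \<Rightarrow> real \<Rightarrow> (nat \<Rightarrow> real) measure" where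
  "noise n \<sigma> = (\<Pi>\<^sub>M i\<in>{1..n}. density lborel (\<lambda>x. ennreal (normal_density 0 \<sigma> x)))"

text \<open>
  The expectation is a nonnegative integral, so that neither it nor its supremum over \<open>\<mu>\<close>
  can degenerate to a default value when infinite.
\<close>

definition lse_risk :: "nat \<Rightarrow> (nat \<times> nat) set \<Rightarrow> real \<Rightarrow> (nat \<Rightarrow> real) \<Rightarrow> ennreal" where
  "lse_risk n E \<sigma> \<mu> =
     (\<integral>\<^sup>+ \<epsilon>. ennreal (1 / real n *
        (L2_set (\<lambda>i. lse n E (\<lambda>k\<in>{1..n}. \<mu> k + \<epsilon> k) i - \<mu> i) {1..n})\<^sup>2) \<partial>noise n \<sigma>)"

end

theory Submission
  imports Defs
begin

text \<open>
  Comparing the least squares estimator with the truth gives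
  \<open>R\<^sup>2 \<le> 2 \<langle>\<epsilon>, \<mu>' - \<mu>\<rangle>\<close>, where \<open>\<mu>'\<close> is the estimator and \<open>R = \<parallel>\<mu>' - \<mu>\<parallel>\<close>.  A flow sums to at
  most its root value on every level of the tree, so the right-hand side is at most
  \<open>2 M (\<mu>'\<^sub>1 + \<mu>\<^sub>1) \<le> 2 M (2 V + R)\<close>, where \<open>M\<close> is the sum over the \<open>h + 1\<close> levels of the
  largest \<open>\<bar>\<epsilon>\<^sub>i\<bar>\<close> on the level; hence \<open>R\<^sup>2 \<le> 8 V M + 4 M\<^sup>2\<close>.  With \<open>L = ln (n / h)\<close>, the bound
  \<open>x \<le> L + exp (x - L)\<close> applied to \<open>\<epsilon>\<^sub>i\<^sup>2 / (4 \<sigma>\<^sup>2)\<close> controls the maxima by exponential moments, and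
  summing over all levels gives \<open>E M\<^sup>2 = O(\<sigma>\<^sup>2 h\<^sup>2 L)\<close> as long as \<open>n \<ge> 2 h\<close>.  For \<open>n < 2 h\<close> the
  bound \<open>R \<le> 2 \<parallel>\<epsilon>\<parallel>\<close> is already good enough.
\<close>

section \<open>Depth and levels in a rooted tree\<close>

lemma rooted_tree_parent_unique:
  assumes "rooted_tree n E" "(i, j) \<in> E" "(k, j) \<in> E"
  shows "i = k"
proof -
  have "j \<in> {1..n} - {1}" using assms(1,2) by (auto simp: rooted_tree_def)
  then have "\<exists>!i. (i, j) \<in> E" using assms(1) by (auto simp: rooted_tree_def)
  then show ?thesis using assms(2,3) by blast
qed

text \<open>Parents are unique and the root has none, so tracing a directed walk backwards from its
  endpoint leaves no choice, not even of where to stop. Hence each node has a single depth.\<close>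

lemma rooted_tree_relpow_unique:
  assumes T: "rooted_tree n E" and "(1, i) \<in> E ^^ k" "(1, i) \<in> E ^^ l"
  shows "k = l"
  using assms(2,3)
proof (induction k arbitrary: i l)
  case 0
  then show ?case using T by (cases l) (auto simp: rooted_tree_def)
next
  case (Suc k)
  obtain p where p: "(1, p) \<in> E ^^ k" "(p, i) \<in> E" using Suc.prems(1) by auto
  then obtain l' where l': "l = Suc l'"
    using T Suc.prems(2) by (cases l) (auto simp: rooted_tree_def)
  then obtain q where "(1, q) \<in> E ^^ l'" "(q, i) \<in> E" using Suc.prems(2) by auto
  then show ?case using Suc.IH p rooted_tree_parent_unique[OF T] l' by metis
qed

text \<open>Going up to a parent cancels the last edge of the directed walk found so far, and going
  down appends an edge, so directed walks are never longer. This reduces the undirected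
  \<open>graph_dist\<close> to directed depth.\<close>

lemma rooted_tree_directed_walk:
  assumes T: "rooted_tree n E" and "(1, i) \<in> (E \<union> E\<inverse>) ^^ m"
  shows "\<exists>k\<le>m. (1, i) \<in> E ^^ k"
  using assms(2)
proof (induction m arbitrary: i)
  case (Suc m)
  then obtain j where j: "(1, j) \<in> (E \<union> E\<inverse>) ^^ m" "(j, i) \<in> E \<union> E\<inverse>" by auto
  from Suc.IH[OF j(1)] obtain k where k: "k \<le> m" "(1, j) \<in> E ^^ k" by blast
  show ?case
  proof (cases "(j, i) \<in> E")
    case True
    then have "(1, i) \<in> E ^^ Suc k" using k by auto
    then show ?thesis using k by (metis Suc_le_mono)
  next
    case False
    then have ij: "(i, j) \<in> E" using j by auto
    \<comment> \<open>The node \<open>j\<close> has the parent \<open>i\<close>, so it is not the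
      root and the walk to it is not empty. Its last edge must come from \<open>i\<close>.\<close>
    then obtain k' where k': "k = Suc k'"
      using T k by (cases k) (auto simp: rooted_tree_def)
    then obtain p where "(1, p) \<in> E ^^ k'" "(p, j) \<in> E" using k by auto
    then have "(1, i) \<in> E ^^ k'" using rooted_tree_parent_unique[OF T ij] by metis
    then show ?thesis using k k' by (metis Suc_leD le_SucI)
  qed
qed auto

lemma graph_dist_root_eqI:
  assumes T: "rooted_tree n E" and k: "(1, i) \<in> E ^^ k"
  shows "graph_dist E 1 i = k"
  unfolding graph_dist_def
proof (rule Least_equality)
  show "(1, i) \<in> (E \<union> E\<inverse>) ^^ k"
    using k by (induction k arbitrary: i) auto
  show "k \<le> m" if "(1, i) \<in> (E \<union> E\<inverse>) ^^ m" for m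
    using rooted_tree_directed_walk[OF T that] rooted_tree_relpow_unique[OF T k] by blast
qed

lemma graph_dist_root_relpow:
  assumes T: "rooted_tree n E" and i: "i \<in> {1..n}"
  shows "(1, i) \<in> E ^^ graph_dist E 1 i"
proof -
  have "(1, i) \<in> E\<^sup>*" using assms by (auto simp: rooted_tree_def)
  then obtain k where "(1, i) \<in> E ^^ k" using rtrancl_imp_relpow by blast
  then show ?thesis using graph_dist_root_eqI[OF T] by metis
qed

lemma graph_dist_root_self: "graph_dist E 1 1 = 0"
  unfolding graph_dist_def by (rule Least_eq_0) simp

lemma graph_dist_root_child:
  assumes T: "rooted_tree n E" and e: "(i, j) \<in> E"
  shows "graph_dist E 1 j = Suc (graph_dist E 1 i)"
proof (rule graph_dist_root_eqI[OF T])
  have "i \<in> {1..n}" using assms by (auto simp: rooted_tree_def)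
  from graph_dist_root_relpow[OF T this] e
  show "(1, j) \<in> E ^^ Suc (graph_dist E 1 i)" by auto
qed

definition level :: "nat \<Rightarrow> (nat \<times> nat) set \<Rightarrow> nat \<Rightarrow> nat set" where
  "level n E d = {i \<in> {1..n}. graph_dist E 1 i = d}"

lemma finite_level [simp]: "finite (level n E d)"
  by (simp add: level_def)

lemma level_0:
  assumes T: "rooted_tree n E"
  shows "level n E 0 = {1}"
proof -
  have "i = 1" if "i \<in> {1..n}" "graph_dist E 1 i = 0" for i
    using graph_dist_root_relpow[OF T that(1)] that(2) by auto
  moreover have "1 \<in> {1..n}" using T by (auto simp: rooted_tree_def)
  ultimately show ?thesis using graph_dist_root_self[of E] by (auto simp: level_def)
qed

lemma level_Suc:
  assumes T: "rooted_tree n E"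
  shows "level n E (Suc d) = (\<Union>i\<in>level n E d. children E i)"
proof (intro equalityI subsetI)
  fix j assume j: "j \<in> level n E (Suc d)"
  then have "(1, j) \<in> E ^^ Suc d"
    using graph_dist_root_relpow[OF T, of j] by (auto simp: level_def)
  then obtain p where p: "(1, p) \<in> E ^^ d" "(p, j) \<in> E" by auto
  then have "p \<in> {1..n}" using T by (auto simp: rooted_tree_def)
  then show "j \<in> (\<Union>i\<in>level n E d. children E i)"
    using p graph_dist_root_eqI[OF T p(1)] by (auto simp: level_def children_def)
next
  fix j assume "j \<in> (\<Union>i\<in>level n E d. children E i)"
  then obtain i where i: "i \<in> level n E d" "(i, j) \<in> E" by (auto simp: children_def)
  then have "j \<in> {1..n}" using T by (auto simp: rooted_tree_def)
  then show "j \<in> level n E (Suc d)"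
    using i graph_dist_root_child[OF T i(2)] by (auto simp: level_def)
qed

lemma finite_children: "rooted_tree n E \<Longrightarrow> finite (children E i)"
  by (rule finite_subset[of _ "{1..n}"]) (auto simp: rooted_tree_def children_def)

text \<open>A node of maximal depth is a leaf, since a child would lie one deeper. The maximum over
  the leaves is therefore the maximum over all nodes.\<close>

lemma tree_height_eq_Max:
  assumes T: "rooted_tree n E"
  shows "tree_height n E = Max (graph_dist E 1 ` {1..n})"
proof -
  let ?D = "graph_dist E 1 ` {1..n}"
  have ne: "?D \<noteq> {}" "finite ?D" using T by (auto simp: rooted_tree_def)
  from Max_in[OF ne(2,1)] obtain i where i: "i \<in> {1..n}" "graph_dist E 1 i = Max ?D" by auto
  have "children E i = {}"
  proof (rule ccontr)
    assume "children E i \<noteq> {}"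
    then obtain j where j: "(i, j) \<in> E" by (auto simp: children_def)
    then have "j \<in> {1..n}" using T by (auto simp: rooted_tree_def)
    then have "graph_dist E 1 j \<le> Max ?D" using ne by auto
    then show False using graph_dist_root_child[OF T j] i by simp
  qed
  then have "i \<in> leaves n E" using i by (auto simp: leaves_def)
  then have "Max ?D \<in> graph_dist E 1 ` leaves n E" using i(2) by (metis imageI)
  moreover have "finite (graph_dist E 1 ` leaves n E)" by (auto simp: leaves_def)
  moreover have "x \<le> Max ?D" if "x \<in> graph_dist E 1 ` leaves n E" for x
    using that ne by (auto simp: leaves_def)
  ultimately show ?thesis unfolding tree_height_def by (intro Max_eqI)
qed

lemma graph_dist_root_le_height:
  assumes "rooted_tree n E" "i \<in> {1..n}"
  shows "graph_dist E 1 i \<le> tree_height n E"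
  using assms by (simp add: tree_height_eq_Max)

lemma sum_nodes_by_level:
  fixes f :: "nat \<Rightarrow> real"
  assumes "rooted_tree n E"
  shows "(\<Sum>i=1..n. f i) = (\<Sum>d\<le>tree_height n E. \<Sum>i\<in>level n E d. f i)"
  unfolding level_def
  by (rule sum.group[symmetric]) (use graph_dist_root_le_height[OF assms] in auto)

lemma height_pos:
  assumes T: "rooted_tree n E" and n: "n \<ge> 2"
  shows "tree_height n E \<ge> 1"
proof -
  have "graph_dist E 1 2 \<noteq> 0"
  proof
    assume "graph_dist E 1 2 = 0"
    then have "2 \<in> level n E 0" using n by (simp add: level_def)
    then show False using level_0[OF T] by simp
  qed
  then show ?thesis using graph_dist_root_le_height[OF T, of 2] n by simp
qed

text \<open>The deepest level is inhabited, and an inhabited level has an inhabited predecessor, so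
  the \<open>n\<close> nodes realise all \<open>h + 1\<close> depths. For \<open>h >= 1\<close> this
  makes \<open>ln (n / h)\<close> strictly positive.\<close>

lemma height_less_nodes:
  assumes T: "rooted_tree n E"
  shows "tree_height n E < n"
proof -
  let ?h = "tree_height n E"
  have "level n E ?h \<noteq> {}"
  proof -
    have "?h \<in> graph_dist E 1 ` {1..n}"
      unfolding tree_height_eq_Max[OF T] by (rule Max_in) (use T in \<open>auto simp: rooted_tree_def\<close>)
    then show ?thesis by (auto simp: level_def)
  qed
  moreover have "level n E d \<noteq> {}" if "level n E (Suc d) \<noteq> {}" for d
    using that level_Suc[OF T, of d] by auto
  ultimately have "level n E d \<noteq> {}" if "d \<le> ?h" for d
    using that inc_induct[of d ?h "\<lambda>d. level n E d \<noteq> {}"] by blast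
  then have "{..?h} \<subseteq> graph_dist E 1 ` {1..n}" by (fastforce simp: level_def)
  then have "card {..?h} \<le> card {1..n}" by (rule surj_card_le[OF finite_atLeastAtMost])
  then show ?thesis by simp
qed

section \<open>Flows on the levels of the tree\<close>

lemma flow_nonneg:
  assumes T: "rooted_tree n E" and f: "f \<in> flows n E" and i: "i \<in> {1..n}"
  shows "f i \<ge> 0"
  using i
\<comment> \<open>The induction runs from the deepest nodes towards the root; at a leaf the bounding
  sum is empty, hence 0.\<close>
proof (induction "tree_height n E - graph_dist E 1 i" arbitrary: i rule: less_induct)
  case less
  have "f j \<ge> 0" if "j \<in> children E i" for j
  proof -
    have e: "(i, j) \<in> E" using that by (simp add: children_def)
    then have j: "j \<in> {1..n}" using T by (auto simp: rooted_tree_def)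
    show ?thesis
      using graph_dist_root_child[OF T e] graph_dist_root_le_height[OF T j] j
      by (intro less.hyps) auto
  qed
  then have "0 \<le> (\<Sum>j\<in>children E i. f j)" by (intro sum_nonneg)
  also have "\<dots> \<le> f i" using f less.prems by (auto simp: flows_def)
  finally show ?case .
qed

text \<open>Adding the flow constraints over one level bounds the total of the next level by the
  total of this one, so level totals decrease from the root value.\<close>

lemma flow_level_sum_le:
  assumes T: "rooted_tree n E" and f: "f \<in> flows n E"
  shows "(\<Sum>i\<in>level n E d. f i) \<le> f 1"
proof (induction d)
  case 0
  then show ?case using level_0[OF T] by simp
next
  case (Suc d)
  have "(\<Sum>i\<in>level n E (Suc d). f i) = (\<Sum>i\<in>level n E d. \<Sum>j\<in>children E i. f j)"
    unfolding level_Suc[OF T]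
    by (rule sum.UNION_disjoint)
       (use finite_children[OF T] rooted_tree_parent_unique[OF T] in \<open>auto simp: children_def\<close>)
  also have "\<dots> \<le> (\<Sum>i\<in>level n E d. f i)"
    using f by (intro sum_mono) (auto simp: flows_def level_def)
  finally show ?case using Suc by simp
qed

section \<open>Existence of the least squares estimator\<close>

lemma exists_flow_minimizer:
  fixes Y :: "nat \<Rightarrow> real"
  assumes T: "rooted_tree n E"
  shows "\<exists>f\<in>flows n E. \<forall>g\<in>flows n E. (\<Sum>i=1..n. (Y i - f i)\<^sup>2) \<le> (\<Sum>i=1..n. (Y i - g i)\<^sup>2)"
proof -
  define G where "G = (\<lambda>f. \<Sum>i=1..n. (Y i - f i)\<^sup>2)"
  define z :: "nat \<Rightarrow> real" where "z = (\<lambda>i\<in>{1..n}. 0)"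
  have child: "j \<in> {1..n}" if "j \<in> children E i" for i j
    using that T by (auto simp: children_def rooted_tree_def)
  then have z: "z \<in> flows n E" by (auto simp: flows_def z_def intro!: sum_nonpos)
  \<comment> \<open>Only flows that fit at least as well as the zero flow \<open>z\<close> matter,
    and each of their coordinates lies within \<open>r\<close> of \<open>Y i\<close>. They fill a
    closed part of a product of compact sets; the singleton factors outside \<open>{1..n}\<close>
    encode extensionality and keep the product compact.\<close>
  define r where "r = sqrt (G z)"
  define K where "K = PiE UNIV (\<lambda>i. if i \<in> {1..n} then {Y i - r..Y i + r} else {undefined})"
  define S where "S = K \<inter> (\<Inter>i\<in>{1..n}. {f. (\<Sum>j\<in>children E i. f j) \<le> f i})"
  have cont: "continuous_on A (\<lambda>f. f i)" for i :: nat and A :: "(nat \<Rightarrow> real) set"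
    by (rule continuous_on_subset[OF continuous_on_product_coordinates]) simp
  have "compactin (product_topology (\<lambda>i. euclidean) UNIV) K"
    unfolding K_def by (subst compactin_PiE) auto
  then have "compact K" by (simp add: euclidean_product_topology)
  moreover have "closed (\<Inter>i\<in>{1..n}. {f :: nat \<Rightarrow> real. (\<Sum>j\<in>children E i. f j) \<le> f i})"
    by (intro closed_INT ballI closed_Collect_le continuous_intros cont)
  ultimately have S: "compact S" unfolding S_def by (rule compact_Int_closed)
  have contG: "continuous_on S G" unfolding G_def by (intro continuous_intros cont)
  have SF: "f \<in> flows n E" if "f \<in> S" for f
  proof -
    have "f i = undefined" if "i \<notin> {1..n}" for i
      using \<open>f \<in> S\<close> that by (auto simp: S_def K_def PiE_iff dest!: spec[of _ i])
    then show ?thesis using that by (auto simp: S_def flows_def extensional_def)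
  qed
  have FS: "f \<in> S" if f: "f \<in> flows n E" and le: "G f \<le> G z" for f
  proof -
    have "\<bar>Y i - f i\<bar> \<le> r" if "i \<in> {1..n}" for i
    proof -
      have "(Y i - f i)\<^sup>2 \<le> G f" unfolding G_def
        by (rule member_le_sum) (use that in auto)
      then have "(Y i - f i)\<^sup>2 \<le> G z" using le by simp
      then show ?thesis unfolding r_def by (metis real_sqrt_abs real_sqrt_le_mono)
    qed
    then show ?thesis using f
      by (fastforce simp: S_def K_def flows_def extensional_def PiE_iff abs_le_iff)
  qed
  have "S \<noteq> {}" using FS[OF z] by auto
  from continuous_attains_inf[OF S this contG]
  obtain f where f: "f \<in> S" "\<forall>g\<in>S. G f \<le> G g" by blast
  \<comment> \<open>A flow outside \<open>S\<close> is worse than \<open>z\<close>, and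
    \<open>z\<close> lies in \<open>S\<close>, so the minimiser over \<open>S\<close> beats it as
    well.\<close>
  have "G f \<le> G g" if "g \<in> flows n E" for g
    using f FS[OF z] FS[OF that] by (cases "G g \<le> G z") auto
  then show ?thesis using SF f unfolding G_def by blast
qed

text \<open>\<open>arg_min_on\<close> is a choice operator and carries information only once a
  minimiser is known to exist.\<close>

lemma
  fixes G :: "'a \<Rightarrow> 'b::linorder"
  assumes "x \<in> S" and "\<forall>y\<in>S. G x \<le> G y"
  shows arg_min_on_attained: "arg_min_on G S \<in> S"
    and arg_min_on_le: "y \<in> S \<Longrightarrow> G (arg_min_on G S) \<le> G y"
proof -
  have "arg_min_on G S \<in> S \<and> (\<forall>y. y \<in> S \<longrightarrow> \<not> G y < G (arg_min_on G S))"
    unfolding arg_min_on_def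
    by (rule arg_minI[of "\<lambda>x. x \<in> S" x G]) (use assms in \<open>auto simp: not_less\<close>)
  then show "arg_min_on G S \<in> S" "y \<in> S \<Longrightarrow> G (arg_min_on G S) \<le> G y"
    by (auto simp: not_less)
qed

lemma
  assumes T: "rooted_tree n E"
  shows lse_in_flows: "lse n E Y \<in> flows n E"
    and lse_le: "g \<in> flows n E \<Longrightarrow>
      (\<Sum>i=1..n. (Y i - lse n E Y i)\<^sup>2) \<le> (\<Sum>i=1..n. (Y i - g i)\<^sup>2)"
proof -
  obtain f where f: "f \<in> flows n E"
    "\<forall>g\<in>flows n E. (\<Sum>i=1..n. (Y i - f i)\<^sup>2) \<le> (\<Sum>i=1..n. (Y i - g i)\<^sup>2)"
    using exists_flow_minimizer[OF T] by blast
  show "lse n E Y \<in> flows n E"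
    unfolding lse_def using f by (rule arg_min_on_attained)
  show "(\<Sum>i=1..n. (Y i - lse n E Y i)\<^sup>2) \<le> (\<Sum>i=1..n. (Y i - g i)\<^sup>2)" if "g \<in> flows n E"
    unfolding lse_def using f that by (rule arg_min_on_le)
qed

section \<open>Pointwise bounds on the estimation error\<close>

lemma lse_basic_inequality:
  fixes \<mu> \<epsilon> :: "nat \<Rightarrow> real"
  assumes T: "rooted_tree n E" and \<mu>: "\<mu> \<in> flows n E"
  defines "f \<equiv> lse n E (\<lambda>k\<in>{1..n}. \<mu> k + \<epsilon> k)"
  shows "(\<Sum>i=1..n. (f i - \<mu> i)\<^sup>2) \<le> 2 * (\<Sum>i=1..n. \<epsilon> i * (f i - \<mu> i))"
proof -
  \<comment> \<open>The true flow is itself a competitor in the minimisation. Expanding the squares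
    then leaves only the error and its cross term with the noise.\<close>
  have "(\<Sum>i=1..n. ((\<mu> i + \<epsilon> i) - f i)\<^sup>2) \<le> (\<Sum>i=1..n. ((\<mu> i + \<epsilon> i) - \<mu> i)\<^sup>2)"
    using lse_le[OF T \<mu>, of "\<lambda>k\<in>{1..n}. \<mu> k + \<epsilon> k"] by (simp add: f_def)
  moreover have "(\<Sum>i=1..n. ((\<mu> i + \<epsilon> i) - f i)\<^sup>2) - (\<Sum>i=1..n. ((\<mu> i + \<epsilon> i) - \<mu> i)\<^sup>2)
     = (\<Sum>i=1..n. (f i - \<mu> i)\<^sup>2) - 2 * (\<Sum>i=1..n. \<epsilon> i * (f i - \<mu> i))"
    unfolding sum_subtractf[symmetric] sum_distrib_left
    by (intro sum.cong) (auto simp: power2_eq_square algebra_simps)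
  ultimately show ?thesis by simp
qed

text \<open>Young's inequality splits the cross term so that half of the squared error can be
  absorbed on the left. This serves trees with \<open>n < 2 h\<close>.\<close>

lemma lse_error_le_noise:
  fixes \<mu> \<epsilon> :: "nat \<Rightarrow> real"
  assumes T: "rooted_tree n E" and \<mu>: "\<mu> \<in> flows n E"
  defines "f \<equiv> lse n E (\<lambda>k\<in>{1..n}. \<mu> k + \<epsilon> k)"
  shows "(\<Sum>i=1..n. (f i - \<mu> i)\<^sup>2) \<le> 4 * (\<Sum>i=1..n. (\<epsilon> i)\<^sup>2)"
proof -
  have "(\<Sum>i=1..n. (f i - \<mu> i)\<^sup>2) \<le> (\<Sum>i=1..n. 2 * (\<epsilon> i * (f i - \<mu> i)))"
    using lse_basic_inequality[OF T \<mu>] by (simp add: f_def sum_distrib_left)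
  also have "\<dots> \<le> (\<Sum>i=1..n. 2 * (\<epsilon> i)\<^sup>2 + (f i - \<mu> i)\<^sup>2 / 2)"
  proof (rule sum_mono)
    fix i
    have "0 \<le> (2 * \<epsilon> i - (f i - \<mu> i))\<^sup>2" by simp
    then show "2 * (\<epsilon> i * (f i - \<mu> i)) \<le> 2 * (\<epsilon> i)\<^sup>2 + (f i - \<mu> i)\<^sup>2 / 2"
      by (simp add: power2_eq_square field_simps)
  qed
  also have "\<dots> = 2 * (\<Sum>i=1..n. (\<epsilon> i)\<^sup>2) + (\<Sum>i=1..n. (f i - \<mu> i)\<^sup>2) / 2"
    by (simp only: sum.distrib sum_distrib_left sum_divide_distrib)
  finally show ?thesis by simp
qed

text \<open>On each level the error is dominated by the sum of two nonnegative flows, whose totals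
  are at most their root values. The root coordinate of the error is at most \<open>R\<close>, so
  the noise pairing is bounded by a multiple of \<open>2 * V + R\<close>. The truncation
  \<open>max 0\<close> makes the weights nonnegative for any choice of \<open>m\<close>.\<close>

lemma lse_error_le_levels:
  fixes \<mu> \<epsilon> :: "nat \<Rightarrow> real"
  assumes T: "rooted_tree n E" and \<mu>: "\<mu> \<in> flows n E" "\<mu> 1 \<le> V"
    and m: "\<And>d i. i \<in> level n E d \<Longrightarrow> \<bar>\<epsilon> i\<bar> \<le> m d"
  defines "f \<equiv> lse n E (\<lambda>k\<in>{1..n}. \<mu> k + \<epsilon> k)"
  defines "M \<equiv> \<Sum>d\<le>tree_height n E. max 0 (m d)"
  shows "(\<Sum>i=1..n. (f i - \<mu> i)\<^sup>2) \<le> 8 * V * M + 4 * M\<^sup>2"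
proof -
  have f: "f \<in> flows n E" using lse_in_flows[OF T] by (simp add: f_def)
  have M0: "M \<ge> 0" unfolding M_def by (intro sum_nonneg) auto
  define R where "R = sqrt (\<Sum>i=1..n. (f i - \<mu> i)\<^sup>2)"
  have R2: "R\<^sup>2 = (\<Sum>i=1..n. (f i - \<mu> i)\<^sup>2)"
    unfolding R_def by (intro real_sqrt_pow2 sum_nonneg) auto
  have one: "1 \<in> {1..n}" using T by (auto simp: rooted_tree_def)
  have "(f 1 - \<mu> 1)\<^sup>2 \<le> (\<Sum>i=1..n. (f i - \<mu> i)\<^sup>2)"
    by (rule member_le_sum) (use one in auto)
  then have "\<bar>f 1 - \<mu> 1\<bar> \<le> R" unfolding R_def by (metis real_sqrt_abs real_sqrt_le_mono)
  then have f1: "f 1 + \<mu> 1 \<le> 2 * V + R" using \<mu>(2) by linarith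
  have "(\<Sum>i=1..n. \<epsilon> i * (f i - \<mu> i))
      = (\<Sum>d\<le>tree_height n E. \<Sum>i\<in>level n E d. \<epsilon> i * (f i - \<mu> i))"
    by (rule sum_nodes_by_level[OF T])
  also have "\<dots> \<le> (\<Sum>d\<le>tree_height n E. max 0 (m d) * (f 1 + \<mu> 1))"
  proof (rule sum_mono)
    fix d
    have "(\<Sum>i\<in>level n E d. \<epsilon> i * (f i - \<mu> i)) \<le> (\<Sum>i\<in>level n E d. max 0 (m d) * (f i + \<mu> i))"
    proof (rule sum_mono)
      fix i assume i: "i \<in> level n E d"
      then have "f i \<ge> 0" "\<mu> i \<ge> 0"
        using flow_nonneg[OF T f] flow_nonneg[OF T \<mu>(1)] by (auto simp: level_def)
      then have "\<bar>f i - \<mu> i\<bar> \<le> f i + \<mu> i" by linarith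
      moreover have "\<bar>\<epsilon> i\<bar> \<le> max 0 (m d)" using m[OF i] by linarith
      ultimately have "\<bar>\<epsilon> i\<bar> * \<bar>f i - \<mu> i\<bar> \<le> max 0 (m d) * (f i + \<mu> i)"
        by (intro mult_mono) auto
      then show "\<epsilon> i * (f i - \<mu> i) \<le> max 0 (m d) * (f i + \<mu> i)"
        by (metis abs_ge_self abs_mult order_trans)
    qed
    also have "\<dots> = max 0 (m d) * ((\<Sum>i\<in>level n E d. f i) + (\<Sum>i\<in>level n E d. \<mu> i))"
      by (simp only: sum_distrib_left[symmetric] sum.distrib)
    also have "\<dots> \<le> max 0 (m d) * (f 1 + \<mu> 1)"
      by (intro mult_left_mono add_mono flow_level_sum_le[OF T] f \<mu>) auto
    finally show "(\<Sum>i\<in>level n E d. \<epsilon> i * (f i - \<mu> i)) \<le> max 0 (m d) * (f 1 + \<mu> 1)" .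
  qed
  also have "\<dots> = M * (f 1 + \<mu> 1)" by (simp only: M_def sum_distrib_right)
  also have "\<dots> \<le> M * (2 * V + R)" using f1 M0 by (rule mult_left_mono)
  finally have "R\<^sup>2 \<le> 2 * (M * (2 * V + R))"
    using lse_basic_inequality[OF T \<mu>(1), of \<epsilon>] R2 by (simp add: f_def)
  \<comment> \<open>This gives \<open>2 M R <= R^2 / 2 + 2 M^2\<close>, which removes
    \<open>R\<close> from the right-hand side.\<close>
  moreover have "0 \<le> (R - 2 * M)\<^sup>2" by simp
  ultimately have "R\<^sup>2 \<le> 8 * V * M + 4 * M\<^sup>2" by (simp add: power2_eq_square algebra_simps)
  then show ?thesis using R2 by simp
qed

section \<open>Exponential moments of squared Gaussian noise\<close>

lemma exp_square_moment_normal: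
  assumes "\<sigma> > 0"
  shows "(\<integral>\<^sup>+ x. ennreal (exp (x\<^sup>2 / (4 * \<sigma>\<^sup>2)))
           \<partial>density lborel (\<lambda>x. ennreal (normal_density 0 \<sigma> x))) = ennreal (sqrt 2)"
proof -
  interpret N: prob_space "density lborel (\<lambda>x. ennreal (normal_density 0 (sqrt 2 * \<sigma>) x))"
    using assms by (intro prob_space_normal_density) auto
  \<comment> \<open>Dividing by \<open>4 * \<sigma>\<^sup>2\<close> halves the Gaussian exponent, so
    the weighted density is again Gaussian with doubled variance; \<open>sqrt 2\<close> is the ratio
    of the normalising constants.\<close>
  have eq: "normal_density 0 \<sigma> x * exp (x\<^sup>2 / (4 * \<sigma>\<^sup>2)) = sqrt 2 * normal_density 0 (sqrt 2 * \<sigma>) x"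
    for x
  proof -
    have "exp (- x\<^sup>2 / (2 * \<sigma>\<^sup>2)) * exp (x\<^sup>2 / (4 * \<sigma>\<^sup>2)) = exp (- x\<^sup>2 / (4 * \<sigma>\<^sup>2))"
      using assms by (simp add: exp_add[symmetric] field_simps)
    then show ?thesis using assms
      by (simp add: normal_density_def real_sqrt_mult power_mult_distrib field_simps)
  qed
  have "(\<integral>\<^sup>+ x. ennreal (exp (x\<^sup>2 / (4 * \<sigma>\<^sup>2)))
           \<partial>density lborel (\<lambda>x. ennreal (normal_density 0 \<sigma> x)))
      = (\<integral>\<^sup>+ x. ennreal (normal_density 0 \<sigma> x) * ennreal (exp (x\<^sup>2 / (4 * \<sigma>\<^sup>2))) \<partial>lborel)"
    by (subst nn_integral_density) auto
  also have "\<dots> = (\<integral>\<^sup>+ x. ennreal (sqrt 2) * ennreal (normal_density 0 (sqrt 2 * \<sigma>) x) \<partial>lborel)"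
    by (simp add: ennreal_mult''[symmetric] eq normal_density_nonneg)
  also have "\<dots> = ennreal (sqrt 2) * (\<integral>\<^sup>+ x. ennreal (normal_density 0 (sqrt 2 * \<sigma>) x) \<partial>lborel)"
    by (rule nn_integral_cmult) auto
  also have "(\<integral>\<^sup>+ x. ennreal (normal_density 0 (sqrt 2 * \<sigma>) x) \<partial>lborel) = 1"
    using N.emeasure_space_1 by (simp add: emeasure_density)
  finally show ?thesis by simp
qed

lemma
  assumes \<sigma>: "\<sigma> > 0"
  shows prob_space_noise: "prob_space (noise n \<sigma>)"
    and exp_square_moment_noise: "i \<in> {1..n} \<Longrightarrow>
      (\<integral>\<^sup>+ \<epsilon>. ennreal (exp ((\<epsilon> i)\<^sup>2 / (4 * \<sigma>\<^sup>2))) \<partial>noise n \<sigma>) = ennreal (sqrt 2)"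
proof -
  let ?N = "density lborel (\<lambda>x. ennreal (normal_density 0 \<sigma> x))"
  interpret N: prob_space ?N using \<sigma> by (rule prob_space_normal_density)
  interpret P: product_prob_space "\<lambda>_. ?N" "{1..n}" by unfold_locales
  show "prob_space (noise n \<sigma>)" unfolding noise_def by (rule P.prob_space_axioms)
  assume i: "i \<in> {1..n}"
  have "(\<integral>\<^sup>+ \<epsilon>. ennreal (exp ((\<epsilon> i)\<^sup>2 / (4 * \<sigma>\<^sup>2))) \<partial>noise n \<sigma>)
      = (\<integral>\<^sup>+ x. ennreal (exp (x\<^sup>2 / (4 * \<sigma>\<^sup>2))) \<partial>distr (noise n \<sigma>) ?N (\<lambda>\<epsilon>. \<epsilon> i))"
    unfolding noise_def using i by (subst nn_integral_distr) auto
  also have "distr (noise n \<sigma>) ?N (\<lambda>\<epsilon>. \<epsilon> i) = ?N"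
    unfolding noise_def using i by (rule P.PiM_component)
  finally show "(\<integral>\<^sup>+ \<epsilon>. ennreal (exp ((\<epsilon> i)\<^sup>2 / (4 * \<sigma>\<^sup>2))) \<partial>noise n \<sigma>) = ennreal (sqrt 2)"
    using exp_square_moment_normal[OF \<sigma>] by simp
qed

lemma nn_integral_noise_affine:
  assumes \<sigma>: "\<sigma> > 0" and "a \<ge> 0" "b \<ge> 0"
  shows "(\<integral>\<^sup>+ \<epsilon>. ennreal (a + b * (\<Sum>i=1..n. exp ((\<epsilon> i)\<^sup>2 / (4 * \<sigma>\<^sup>2)))) \<partial>noise n \<sigma>)
    = ennreal (a + b * (real n * sqrt 2))"
proof -
  interpret prob_space "noise n \<sigma>" using \<sigma> by (rule prob_space_noise)
  have meas [measurable]: "(\<lambda>\<epsilon>. \<epsilon> i) \<in> borel_measurable (noise n \<sigma>)" if "i \<in> {1..n}" for i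
  proof -
    have "(\<lambda>\<epsilon>. \<epsilon> i) \<in> measurable (noise n \<sigma>) (density lborel (\<lambda>x. ennreal (normal_density 0 \<sigma> x)))"
      unfolding noise_def using that by (rule measurable_component_singleton)
    then show ?thesis by simp
  qed
  have "(\<integral>\<^sup>+ \<epsilon>. ennreal (a + b * (\<Sum>i=1..n. exp ((\<epsilon> i)\<^sup>2 / (4 * \<sigma>\<^sup>2)))) \<partial>noise n \<sigma>)
     = (\<integral>\<^sup>+ \<epsilon>. ennreal a + ennreal b * (\<Sum>i=1..n. ennreal (exp ((\<epsilon> i)\<^sup>2 / (4 * \<sigma>\<^sup>2)))) \<partial>noise n \<sigma>)"
    using assms by (simp add: ennreal_mult' sum_nonneg)
  also have "\<dots> = (\<integral>\<^sup>+ \<epsilon>. ennreal a \<partial>noise n \<sigma>)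
      + (\<integral>\<^sup>+ \<epsilon>. ennreal b * (\<Sum>i=1..n. ennreal (exp ((\<epsilon> i)\<^sup>2 / (4 * \<sigma>\<^sup>2)))) \<partial>noise n \<sigma>)"
    by (rule nn_integral_add) measurable
  also have "\<dots> = ennreal a
      + ennreal b * (\<integral>\<^sup>+ \<epsilon>. (\<Sum>i=1..n. ennreal (exp ((\<epsilon> i)\<^sup>2 / (4 * \<sigma>\<^sup>2)))) \<partial>noise n \<sigma>)"
    by (subst nn_integral_cmult, measurable) (simp add: emeasure_space_1)
  also have "(\<integral>\<^sup>+ \<epsilon>. (\<Sum>i=1..n. ennreal (exp ((\<epsilon> i)\<^sup>2 / (4 * \<sigma>\<^sup>2)))) \<partial>noise n \<sigma>)
      = (\<Sum>i=1..n. \<integral>\<^sup>+ \<epsilon>. ennreal (exp ((\<epsilon> i)\<^sup>2 / (4 * \<sigma>\<^sup>2))) \<partial>noise n \<sigma>)"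
    by (rule nn_integral_sum) measurable
  also have "\<dots> = (\<Sum>i=1..n. ennreal (sqrt 2))"
    by (rule sum.cong) (use exp_square_moment_noise[OF \<sigma>] in auto)
  also have "ennreal a + ennreal b * \<dots> = ennreal (a + b * (real n * sqrt 2))"
    using assms by (simp add: ennreal_mult'' ennreal_of_nat_eq_real_of_nat)
  finally show ?thesis .
qed

section \<open>From exponential moments to the risk\<close>

lemma square_le_add_exp:
  fixes x L \<sigma> :: real
  assumes "\<sigma> > 0"
  shows "x\<^sup>2 \<le> 4 * \<sigma>\<^sup>2 * (L + exp (- L) * exp (x\<^sup>2 / (4 * \<sigma>\<^sup>2)))"
proof -
  \<comment> \<open>The offset \<open>L\<close> is free: a larger one discounts the exponential by
    \<open>exp (- L)\<close>, which later offsets the sum over all \<open>n\<close> nodes.\<close>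
  have "x\<^sup>2 / (4 * \<sigma>\<^sup>2) - L \<le> exp (x\<^sup>2 / (4 * \<sigma>\<^sup>2) - L)"
    using exp_ge_add_one_self[of "x\<^sup>2 / (4 * \<sigma>\<^sup>2) - L"] by linarith
  then have "x\<^sup>2 / (4 * \<sigma>\<^sup>2) \<le> L + exp (- L) * exp (x\<^sup>2 / (4 * \<sigma>\<^sup>2))"
    by (simp add: exp_add[symmetric])
  then show ?thesis using assms by (simp add: field_simps)
qed

text \<open>The weight \<open>a\<close> linearises the sum \<open>M\<close> of level bounds through
  \<open>2 M <= a + M^2 / a\<close>, so only \<open>M^2\<close> has to be controlled. The resulting
  bound is affine in the sum of the exponentials, whose expectation is explicit.\<close>

lemma lse_error_le_exp:
  fixes \<mu> \<epsilon> :: "nat \<Rightarrow> real"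
  assumes T: "rooted_tree n E" and \<mu>: "\<mu> \<in> flows n E" "\<mu> 1 \<le> V"
    and pos: "V \<ge> 0" "\<sigma> > 0" "L \<ge> 0" "a > 0"
  defines "f \<equiv> lse n E (\<lambda>k\<in>{1..n}. \<mu> k + \<epsilon> k)"
  defines "H \<equiv> real (tree_height n E) + 1"
  defines "B \<equiv> 4 * \<sigma>\<^sup>2 * H * (H * L + exp (- L) * (\<Sum>i=1..n. exp ((\<epsilon> i)\<^sup>2 / (4 * \<sigma>\<^sup>2))))"
  shows "(\<Sum>i=1..n. (f i - \<mu> i)\<^sup>2) \<le> 4 * V * (a + B / a) + 4 * B"
proof -
  define e where "e = (\<lambda>i. exp ((\<epsilon> i)\<^sup>2 / (4 * \<sigma>\<^sup>2)))"
  \<comment> \<open>The largest exponential on a level is replaced by the sum over that level, so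
    the levels together cost one sum over all nodes.\<close>
  define q where "q = (\<lambda>d. 4 * \<sigma>\<^sup>2 * (L + exp (- L) * (\<Sum>i\<in>level n E d. e i)))"
  have q0: "q d \<ge> 0" for d
    unfolding q_def e_def using pos by (intro mult_nonneg_nonneg add_nonneg_nonneg sum_nonneg) auto
  have m: "\<bar>\<epsilon> i\<bar> \<le> sqrt (q d)" if "i \<in> level n E d" for i d
  proof -
    have "e i \<le> (\<Sum>i\<in>level n E d. e i)"
      by (rule member_le_sum) (use that in \<open>auto simp: e_def\<close>)
    then have "4 * \<sigma>\<^sup>2 * (L + exp (- L) * e i) \<le> q d"
      unfolding q_def by (intro mult_left_mono add_left_mono) auto
    then have "(\<epsilon> i)\<^sup>2 \<le> q d"
      using square_le_add_exp[OF pos(2), of "\<epsilon> i" L] by (simp add: e_def)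
    then show ?thesis by (metis real_sqrt_abs real_sqrt_le_mono)
  qed
  define M where "M = (\<Sum>d\<le>tree_height n E. sqrt (q d))"
  \<comment> \<open>Cauchy-Schwarz over the \<open>h + 1\<close> levels produces the outer factor
    \<open>H\<close>.\<close>
  have "M\<^sup>2 \<le> (\<Sum>d\<le>tree_height n E. (sqrt (q d))\<^sup>2) * (\<Sum>d\<le>tree_height n E. 1\<^sup>2)"
    using Cauchy_Schwarz_ineq_sum[of "\<lambda>d. sqrt (q d)" "\<lambda>_. 1" "{..tree_height n E}"]
    by (simp add: M_def)
  also have "\<dots> = H * (\<Sum>d\<le>tree_height n E. q d)" using q0 by (simp add: H_def)
  also have "(\<Sum>d\<le>tree_height n E. q d)
      = 4 * \<sigma>\<^sup>2 * (H * L + exp (- L) * (\<Sum>d\<le>tree_height n E. \<Sum>i\<in>level n E d. e i))"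
    by (simp add: q_def H_def sum_distrib_left[symmetric] sum.distrib)
  also have "H * \<dots> = B"
    using sum_nodes_by_level[OF T, of e] by (simp add: B_def e_def)
  finally have MB: "M\<^sup>2 \<le> B" .
  have "0 \<le> (M - a)\<^sup>2" by simp
  then have "2 * M * a \<le> a\<^sup>2 + B" using MB by (simp add: power2_eq_square algebra_simps)
  then have "2 * M \<le> a + B / a" using pos by (simp add: field_simps power2_eq_square)
  then have "4 * V * (2 * M) \<le> 4 * V * (a + B / a)" using pos by (intro mult_left_mono) auto
  moreover have "(\<Sum>i=1..n. (f i - \<mu> i)\<^sup>2) \<le> 8 * V * M + 4 * M\<^sup>2"
    using lse_error_le_levels[OF T \<mu> m] q0 by (simp add: f_def M_def max_def)
  ultimately show ?thesis using MB by linarith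
qed

text \<open>The nonnegative integral is monotone without any measurability condition, so the
  estimator is dominated pointwise and only the explicit bound is integrated.\<close>

lemma lse_risk_le:
  assumes \<sigma>: "\<sigma> > 0" and n: "n \<ge> 1" and ab: "a \<ge> 0" "b \<ge> 0"
    and le: "\<And>\<epsilon>. (\<Sum>i=1..n. (lse n E (\<lambda>k\<in>{1..n}. \<mu> k + \<epsilon> k) i - \<mu> i)\<^sup>2)
      \<le> a + b * (\<Sum>i=1..n. exp ((\<epsilon> i)\<^sup>2 / (4 * \<sigma>\<^sup>2)))"
    and K: "a + b * (real n * sqrt 2) \<le> K"
  shows "lse_risk n E \<sigma> \<mu> \<le> ennreal (K / real n)"
proof -
  have "lse_risk n E \<sigma> \<mu> \<le> (\<integral>\<^sup>+ \<epsilon>. ennreal (a / real n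
      + b / real n * (\<Sum>i=1..n. exp ((\<epsilon> i)\<^sup>2 / (4 * \<sigma>\<^sup>2)))) \<partial>noise n \<sigma>)"
    unfolding lse_risk_def
  proof (intro nn_integral_mono ennreal_leI)
    fix \<epsilon> :: "nat \<Rightarrow> real"
    show "1 / real n * (L2_set (\<lambda>i. lse n E (\<lambda>k\<in>{1..n}. \<mu> k + \<epsilon> k) i - \<mu> i) {1..n})\<^sup>2
      \<le> a / real n + b / real n * (\<Sum>i=1..n. exp ((\<epsilon> i)\<^sup>2 / (4 * \<sigma>\<^sup>2)))"
      using divide_right_mono[OF le[of \<epsilon>], of "real n"]
      by (simp add: L2_set_def sum_nonneg add_divide_distrib)
  qed
  also have "\<dots> = ennreal (a / real n + b / real n * (real n * sqrt 2))"
    by (rule nn_integral_noise_affine) (use \<sigma> ab in auto)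
  also have "\<dots> \<le> ennreal (K / real n)"
    using divide_right_mono[OF K, of "real n"] by (intro ennreal_leI) (simp add: add_divide_distrib)
  finally show ?thesis .
qed

lemma lse_risk_bound:
  assumes n: "n \<ge> 2" and T: "rooted_tree n E" and V: "V \<ge> 0" and \<sigma>: "\<sigma> > 0"
    and \<mu>: "\<mu> \<in> flows n E" "\<mu> 1 \<le> V"
  defines "h \<equiv> tree_height n E"
  defines "L \<equiv> ln (real n / real h)"
  shows "lse_risk n E \<sigma> \<mu> \<le> ennreal (200 / real n *
           (\<sigma>\<^sup>2 * (real h)\<^sup>2 * L + real h * V * \<sigma> * sqrt L))"
proof -
  have h: "h \<ge> 1" "h < n"
    using height_pos[OF T n] height_less_nodes[OF T] by (auto simp: h_def)
  have L0: "L > 0" using h by (simp add: L_def)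
  have sqrt2: "sqrt 2 \<le> 3 / 2" by (rule real_le_lsqrt) (auto simp: power2_eq_square)
  \<comment> \<open>The two cases below produce constants 96 and 164, both covered by 200.\<close>
  define K where "K = 200 * (\<sigma>\<^sup>2 * (real h)\<^sup>2 * L + real h * V * \<sigma> * sqrt L)"
  have "lse_risk n E \<sigma> \<mu> \<le> ennreal (K / real n)"
  \<comment> \<open>For \<open>n\<close> close to \<open>h\<close> the logarithm \<open>L\<close> is
    close to 0, and the contribution of order \<open>h\<close> from the exponentials can no longer
    be absorbed into \<open>h * L\<close>.\<close>
  proof (cases "n < 2 * h")
    case True
    show ?thesis
    proof (rule lse_risk_le[OF \<sigma>])
      fix \<epsilon>
      have "(\<Sum>i=1..n. (\<epsilon> i)\<^sup>2) \<le> (\<Sum>i=1..n. 4 * \<sigma>\<^sup>2 * exp ((\<epsilon> i)\<^sup>2 / (4 * \<sigma>\<^sup>2)))"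
        using square_le_add_exp[OF \<sigma>, of _ 0] by (intro sum_mono) simp
      then show "(\<Sum>i=1..n. (lse n E (\<lambda>k\<in>{1..n}. \<mu> k + \<epsilon> k) i - \<mu> i)\<^sup>2)
          \<le> 0 + 16 * \<sigma>\<^sup>2 * (\<Sum>i=1..n. exp ((\<epsilon> i)\<^sup>2 / (4 * \<sigma>\<^sup>2)))"
        using lse_error_le_noise[OF T \<mu>(1), of \<epsilon>] by (simp add: sum_distrib_left[symmetric])
      \<comment> \<open>Since \<open>h < n\<close>, this yields \<open>1 <= n * L\<close>. Together
        with \<open>n < 2 h\<close> it gives \<open>n <= n^2 * L <= 4 h^2 * L\<close>, so the total
        noise energy already has the target order.\<close>
      have "1 - real h / real n \<le> L"
      proof -
        have "ln (real h / real n) \<le> real h / real n - 1"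
          using h by (intro ln_le_minus_one) auto
        then show ?thesis using h by (simp add: L_def ln_div)
      qed
      then have "real n - real h \<le> real n * L" using h by (simp add: field_simps)
      then have nL: "1 \<le> real n * L" using h by linarith
      have "real n * real n \<le> (2 * real h) * (2 * real h)"
        using True by (intro mult_mono) auto
      then have "real n * real n * L \<le> 4 * (real h)\<^sup>2 * L"
        using L0 by (intro mult_right_mono) (auto simp: power2_eq_square)
      moreover have "real n * 1 \<le> real n * (real n * L)" using nL by (intro mult_left_mono) auto
      ultimately have nh: "real n \<le> 4 * (real h)\<^sup>2 * L" by simp
      have "16 * \<sigma>\<^sup>2 * (real n * sqrt 2) \<le> 16 * \<sigma>\<^sup>2 * (4 * (real h)\<^sup>2 * L * (3 / 2))"
        using nh sqrt2 L0 by (intro mult_left_mono mult_mono) auto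
      moreover have "real h * V * \<sigma> * sqrt L \<ge> 0" "\<sigma>\<^sup>2 * (real h)\<^sup>2 * L \<ge> 0"
        using V \<sigma> L0 by auto
      ultimately show "0 + 16 * \<sigma>\<^sup>2 * (real n * sqrt 2) \<le> K"
        unfolding K_def by (simp add: algebra_simps)
    qed (use n in auto)
  next
    case False
    \<comment> \<open>The weight is the expected order of \<open>M\<close>, which balances
      \<open>a\<close> against \<open>B / a\<close>.\<close>
    define a where "a = \<sigma> * real h * sqrt L"
    have a: "a > 0" using \<sigma> h L0 by (simp add: a_def)
    have a2: "a\<^sup>2 = \<sigma>\<^sup>2 * (real h)\<^sup>2 * L" using L0 by (simp add: a_def power_mult_distrib)
    define c where "c = 4 * V / a + 4"
    have c: "c \<ge> 0" using V a by (simp add: c_def)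
    define H where "H = real h + 1"
    have H: "H \<ge> 0" "H \<le> 2 * real h" using h by (auto simp: H_def)
    have "0 \<le> 4 * (V * a) + c * (4 * \<sigma>\<^sup>2 * H * (H * L))" "0 \<le> c * (4 * \<sigma>\<^sup>2 * H * exp (- L))"
      by (intro add_nonneg_nonneg mult_nonneg_nonneg; use V a c H L0 in simp)+
    then show ?thesis
    proof (rule lse_risk_le[OF \<sigma>, rotated])
      fix \<epsilon>
      show "(\<Sum>i=1..n. (lse n E (\<lambda>k\<in>{1..n}. \<mu> k + \<epsilon> k) i - \<mu> i)\<^sup>2)
          \<le> (4 * (V * a) + c * (4 * \<sigma>\<^sup>2 * H * (H * L)))
             + c * (4 * \<sigma>\<^sup>2 * H * exp (- L)) * (\<Sum>i=1..n. exp ((\<epsilon> i)\<^sup>2 / (4 * \<sigma>\<^sup>2)))"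
        using lse_error_le_exp[OF T \<mu> V \<sigma> less_imp_le[OF L0] a, of \<epsilon>]
        unfolding h_def[symmetric] H_def[symmetric] c_def by (simp add: algebra_simps add_divide_distrib)
      have "2 \<le> real n / real h" using False h by (simp add: field_simps)
      then have "ln 2 \<le> L" unfolding L_def by simp
      \<comment> \<open>Here \<open>n >= 2 h\<close> bounds \<open>L\<close> away from 0, so
        constants such as \<open>sqrt 2\<close> are at most \<open>3 * L\<close>.\<close>
      then have L12: "1 \<le> 2 * L" using ln2_ge_two_thirds by linarith
      have regroup: "(x + c * (y * (H * L))) + c * (y * e) * (N * s) = x + c * (y * (H * L + e * N * s))"
        for x y e N s :: real by (simp add: algebra_simps)
      \<comment> \<open>This is what fixes \<open>L = ln (n / h)\<close>: the \<open>n\<close>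
        discounted exponential moments add up to \<open>h * sqrt 2\<close>, no more than the order
        of \<open>h * L\<close>.\<close>
      have eL: "exp (- L) * real n = real h"
        using h by (simp add: L_def exp_minus)
      have "H * L + real h * sqrt 2 \<le> 2 * real h * L + real h * (3 * L)"
        using H L0 L12 sqrt2 by (intro add_mono mult_right_mono mult_left_mono) auto
      then have "4 * \<sigma>\<^sup>2 * H * (H * L + real h * sqrt 2) \<le> 4 * \<sigma>\<^sup>2 * (2 * real h) * (5 * real h * L)"
        using H L0 by (intro mult_mono) (auto simp: algebra_simps)
      also have "\<dots> = 40 * a\<^sup>2" unfolding a2 by (simp add: power2_eq_square)
      finally have "c * (4 * \<sigma>\<^sup>2 * H * (H * L + real h * sqrt 2)) \<le> c * (40 * a\<^sup>2)"
        using c by (rule mult_left_mono)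
      also have "\<dots> = 160 * (V * a) + 160 * a\<^sup>2"
        using a by (simp add: c_def field_simps power2_eq_square)
      finally have "4 * (V * a) + c * (4 * \<sigma>\<^sup>2 * H * (H * L + real h * sqrt 2))
          \<le> 200 * (a\<^sup>2 + V * a)"
        using mult_nonneg_nonneg[OF V less_imp_le[OF a]] zero_le_power2[of a]
        unfolding distrib_left by linarith
      also have "\<dots> = K" by (simp add: K_def a2) (simp add: a_def)
      finally show "(4 * (V * a) + c * (4 * \<sigma>\<^sup>2 * H * (H * L)))
          + c * (4 * \<sigma>\<^sup>2 * H * exp (- L)) * (real n * sqrt 2) \<le> K"
        unfolding regroup eL .
    qed (use n in auto)
  qed
  then show ?thesis by (simp add: K_def)
qed

theorem theorem2p1:
  shows "\<exists>C::real. C > 0 \<and>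
    (\<forall>(n::nat) (E::(nat \<times> nat) set) (h::nat) (V::real) (\<sigma>::real).
       n \<ge> 2 \<longrightarrow> rooted_tree n E \<longrightarrow> h = tree_height n E \<longrightarrow> V \<ge> 0 \<longrightarrow> \<sigma> > 0 \<longrightarrow>
       (SUP \<mu>\<in>{\<mu> \<in> flows n E. \<mu> 1 \<le> V}. lse_risk n E \<sigma> \<mu>)
         \<le> ennreal (C / real n *
             (\<sigma>\<^sup>2 * (real h)\<^sup>2 * ln (real n / real h)
              + real h * V * \<sigma> * sqrt (ln (real n / real h)))))"
proof (intro exI[of _ 200] conjI allI impI SUP_least)
  fix n h :: nat and E :: "(nat \<times> nat) set" and V \<sigma> :: real and \<mu> :: "nat \<Rightarrow> real"
  assume "n \<ge> 2" "rooted_tree n E" "h = tree_height n E" "V \<ge> 0" "\<sigma> > 0"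
    and "\<mu> \<in> {\<mu> \<in> flows n E. \<mu> 1 \<le> V}"
  then show "lse_risk n E \<sigma> \<mu> \<le> ennreal (200 / real n *
      (\<sigma>\<^sup>2 * (real h)\<^sup>2 * ln (real n / real h) + real h * V * \<sigma> * sqrt (ln (real n / real h))))"
    using lse_risk_bound[of n E V \<sigma> \<mu>] by simp
qed simp

end
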